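(* Let $\mathcal{M}$ be either the minority process or the majority process. A tree $T$ with $n$ nodes and maximal degree $\Delta$ has at most $\min\left(2^{n-\Delta}, 2F_{\lfloor n/2\rfloor}\right)$ pure 2-cycles of $\mathcal{M}$.
   Context: Let $T=(V,E)$ be a finite undirected tree. A coloring is a map $c:V\to\{0,1\}$. For a node $v$ and $i\in\{0,1\}$ let $N^i(v)$ be the set of neighbors $u$ of $v$ with $c(u)=i$. The minority process maps $c$ to $\mathcal{MIN}(c)$, where $\mathcal{MIN}(c)(v)=c(v)$ if $|N^{c(v)}(v)|\le |N^{1-c(v)}(v)|$ and $\mathcal{MIN}(c)(v)=1-c(v)$ otherwise, simultaneously for all $v$. The majority process $\mathcal{MAJ}$ is defined with the comparisons reversed: $\mathcal{MAJ}(c)(v)=c(v)$ if $|N^{c(v)}(v)|\ge |N^{1-c(v)}(v)|$ and $1-c(v)$ otherwise. A coloring $c$ is a pure 2-cycle of $\mathcal{M}$ if $\mathcal{M}(c)(v)\neq c(v)$ for every node $v$ and $\mathcal{M}(\mathcal{M}(c))=c$. $F_i$ denotes the $i$-th Fibonacci number: $F_0=0$, $F_1=1$, $F_i=F_{i-1}+F_{i-2}$. *)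

theory Defs
  imports "Graph_Theory.Graph_Theory" "HOL-Number_Theory.Fib" "HOL-Library.FuncSet"
begin

text \<open>
  A \<^locale>\<open>pair_graph\<close> is a finite simple undirected graph, represented by a symmetric irreflexive
  set of arcs: each undirected edge \<open>uv\<close> gives the two arcs \<open>(u, v)\<close> and \<open>(v, u)\<close>. Hence the closed
  walk \<open>u, v, u\<close> is a \<open>cycle\<close> of length 2 in the sense of \<^theory>\<open>Graph_Theory.Arc_Walk\<close> (and the
  predicate \<^const>\<open>tree\<close> of that library fails for every undirected graph with an edge). The cycles
  of the undirected graph are exactly those of length at least 3. Connectedness includes having
  at least one vertex.
\<close>

locale undirected_tree = pair_graph T for T :: "'a pair_pre_digraph" +
  assumes tree_connected: "connected (with_proj T)"
    and tree_acyclic: "\<not> (\<exists>p. pre_digraph.cycle (with_proj T) p \<and> 3 \<le> length p)"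

text \<open>By symmetry of the arc set, the degree of a vertex is its out-degree.\<close>

definition max_degree :: "'a pair_pre_digraph \<Rightarrow> nat" where
  "max_degree T = Max (out_degree (with_proj T) ` pverts T)"

text \<open>Colorings are extensional, so that two colorings are equal iff they agree on the vertices.\<close>

definition colorings :: "'a pair_pre_digraph \<Rightarrow> ('a \<Rightarrow> nat) set" where
  "colorings T = pverts T \<rightarrow>\<^sub>E {0, 1}"

definition colored_nbrs :: "'a pair_pre_digraph \<Rightarrow> ('a \<Rightarrow> nat) \<Rightarrow> nat \<Rightarrow> 'a \<Rightarrow> 'a set" where
  "colored_nbrs T c i v = {u \<in> pverts T. (v, u) \<in> parcs T \<and> c u = i}"

definition minority :: "'a pair_pre_digraph \<Rightarrow> ('a \<Rightarrow> nat) \<Rightarrow> 'a \<Rightarrow> nat" where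
  "minority T c = (\<lambda>v\<in>pverts T.
     if card (colored_nbrs T c (c v) v) \<le> card (colored_nbrs T c (1 - c v) v)
     then c v else 1 - c v)"

definition majority :: "'a pair_pre_digraph \<Rightarrow> ('a \<Rightarrow> nat) \<Rightarrow> 'a \<Rightarrow> nat" where
  "majority T c = (\<lambda>v\<in>pverts T.
     if card (colored_nbrs T c (c v) v) \<ge> card (colored_nbrs T c (1 - c v) v)
     then c v else 1 - c v)"

definition pure_2_cycles ::
  "'a pair_pre_digraph \<Rightarrow> (('a \<Rightarrow> nat) \<Rightarrow> 'a \<Rightarrow> nat) \<Rightarrow> ('a \<Rightarrow> nat) set" where
  "pure_2_cycles T M = {c \<in> colorings T. (\<forall>v\<in>pverts T. M c v \<noteq> c v) \<and> M (M c) = c}"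

text \<open>In particular, the cardinality of the set of pure 2-cycles is a genuine count.\<close>

lemma finite_pure_2_cycles:
  assumes "finite (pverts T)"
  shows "finite (pure_2_cycles T M)"
  using assms by (simp add: pure_2_cycles_def colorings_def finite_PiE)

end

theory Submission
  imports Defs
begin

text \<open>
  Call an edge bad if it speaks against a flip of its endpoints, that is, if it is bichromatic for
  the minority and monochromatic for the majority process. In a pure 2-cycle a node of degree \<open>d\<close> has at most
  \<open>\<lceil>d / 2\<rceil> - 1\<close> bad edges. More generally, for arbitrary capacities \<open>f v\<close>, a tree has at most
  \<open>2 F\<^bsub>1 + \<Sum>f\<^esub>\<close> colorings in which every \<open>v\<close> has at most \<open>f v\<close> bad edges: remove a leaf \<open>v\<close> with
  neighbor \<open>u\<close>; its color is determined by whether \<open>uv\<close> is bad, and if it is bad, the capacity of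
  \<open>u\<close> drops by one. Since the degrees sum to \<open>2 (n - 1)\<close>, the capacities above sum to at most
  \<open>n / 2 - 1\<close>. For the other bound, the color of a leaf is determined by its neighbor, and the degree
  sum shows that there are at least \<open>\<Delta>\<close> leaves.
\<close>

section \<open>Trees grown leaf by leaf\<close>

text \<open>The induction rule removes one leaf at a time. As in \<open>parcs T\<close>, every edge
  is present in both orientations.\<close>

inductive tree_on :: "'a set \<Rightarrow> ('a \<times> 'a) set \<Rightarrow> bool" where
  single: "tree_on {r} {}"
| add_leaf: "tree_on A R \<Longrightarrow> u \<in> A \<Longrightarrow> v \<notin> A \<Longrightarrow> tree_on (insert v A) (R \<union> {(u, v), (v, u)})"

lemma tree_on_finite: "tree_on A R \<Longrightarrow> finite A"
  by (induction rule: tree_on.induct) auto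

lemma tree_on_subset: "tree_on A R \<Longrightarrow> R \<subseteq> A \<times> A"
  by (induction rule: tree_on.induct) auto

lemma tree_on_card_arcs: "tree_on A R \<Longrightarrow> card R + 2 = 2 * card A"
proof (induction rule: tree_on.induct)
  case (add_leaf A R u v)
  note sub = tree_on_subset[OF add_leaf.hyps(1)] and fin = tree_on_finite[OF add_leaf.hyps(1)]
  have "finite R" using finite_subset[OF sub] fin by blast
  moreover have "(u, v) \<notin> R" "(v, u) \<notin> R" "u \<noteq> v" using sub add_leaf.hyps by auto
  ultimately show ?case using fin add_leaf by simp
qed simp

lemma pawalk_verts_snoc:
  "pcas x p u \<Longrightarrow> pawalk_verts x (p @ [(u, v)]) = pawalk_verts x p @ [v]"
  by (induction p arbitrary: x) auto

lemma pcas_snoc: "pcas x p u \<Longrightarrow> pcas x (p @ [(u, v)]) v"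
  by (induction p arbitrary: x) auto

text \<open>Serves to show that a new node with two neighbors in \<open>A\<close> would close a
  cycle. A path from or to the new leaf is one from or to \<open>u\<close>, extended by a single
  arc.\<close>

lemma tree_on_path:
  assumes "tree_on A R" "x \<in> A" "y \<in> A"
  shows "\<exists>p. set p \<subseteq> R \<and> pcas x p y \<and> distinct (pawalk_verts x p) \<and> set (pawalk_verts x p) \<subseteq> A"
  using assms
proof (induction arbitrary: x y rule: tree_on.induct)
  case (single r)
  then show ?case by (intro exI[of _ "[]"]) auto
next
  case (add_leaf A R u v)
  consider "x \<in> A" "y \<in> A" | "x = v" "y = v" | "x = v" "y \<in> A" | "x \<in> A" "y = v"
    using add_leaf.prems by blast
  then show ?case
  proof cases
    case 1
    then show ?thesis using add_leaf.IH[of x y] by blast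
  next
    case 2
    then show ?thesis by (intro exI[of _ "[]"]) auto
  next
    case 3
    with add_leaf.IH[of u y] add_leaf.hyps obtain p where
      "set p \<subseteq> R" "pcas u p y" "distinct (pawalk_verts u p)" "set (pawalk_verts u p) \<subseteq> A" by blast
    with 3 add_leaf.hyps show ?thesis by (intro exI[of _ "(v, u) # p"]) auto
  next
    case 4
    with add_leaf.IH[of x u] add_leaf.hyps obtain p where
      "set p \<subseteq> R" "pcas x p u" "distinct (pawalk_verts x p)" "set (pawalk_verts x p) \<subseteq> A" by blast
    with 4 add_leaf.hyps show ?thesis
      by (intro exI[of _ "p @ [(u, v)]"]) (auto simp: pawalk_verts_snoc pcas_snoc)
  qed
qed

section \<open>Leaf construction, degree sum and leaves of an undirected tree\<close>

context undirected_tree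
begin

text \<open>Otherwise \<open>A\<close> would be closed under arcs, and nothing outside it could be
  reached from \<open>x\<close>.\<close>

lemma arc_leaving:
  assumes "A \<subseteq> pverts T" "x \<in> A" "y \<in> pverts T - A"
  shows "\<exists>u v. u \<in> A \<and> v \<in> pverts T - A \<and> (u, v) \<in> parcs T"
proof (rule ccontr)
  assume closed: "\<not> ?thesis"
  have "reachable (with_proj (mk_symmetric (with_proj T))) x y"
    using tree_connected assms by (auto simp: connected_def strongly_connected_def mk_symmetric_def)
  then have "(x, y) \<in> rtrancl_on (pverts T) (parcs T)"
    using arcs_symmetric by (auto simp: reachable_def mk_symmetric_def elim!: rtrancl_on_mono[rotated -1])
  then have "y \<in> A"
    by (induction rule: rtrancl_on_induct) (use assms closed in_arcsD2 in blast)+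
  with assms show False by simp
qed

text \<open>A largest vertex set whose induced arcs form a \<open>tree_on\<close> is everything:
  otherwise connectedness supplies an arc to a new node \<open>v\<close>, and acyclicity makes
  \<open>v\<close> a leaf of the enlarged set.\<close>

lemma tree_on_graph: "tree_on (pverts T) (parcs T)"
proof -
  define P where "P A \<longleftrightarrow> A \<subseteq> pverts T \<and> tree_on A (parcs T \<inter> A \<times> A)" for A
  obtain r where r: "r \<in> pverts T"
    using tree_connected by (auto simp: connected_def strongly_connected_def mk_symmetric_def)
  have "parcs T \<inter> {r} \<times> {r} = {}" using no_loops' by auto
  with r have "P {r}" using tree_on.single by (simp add: P_def)
  moreover have "\<forall>B. P B \<longrightarrow> card B < Suc (card (pverts T))"
    using pair_finite_verts by (simp add: P_def card_mono less_Suc_eq_le)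
  ultimately have "\<exists>A. P A \<and> (\<forall>B. P B \<longrightarrow> card B \<le> card A)"
    by (rule Lattices_Big.ex_has_greatest_nat)
  then obtain A where "P A" and max: "\<And>B. P B \<Longrightarrow> card B \<le> card A" by blast
  then have A: "A \<subseteq> pverts T" "tree_on A (parcs T \<inter> A \<times> A)" by (simp_all add: P_def)
  have "A = pverts T"
  proof (rule ccontr)
    assume "A \<noteq> pverts T"
    moreover have "A \<noteq> {}" using A by (auto elim: tree_on.cases)
    ultimately obtain u v where uv: "u \<in> A" "v \<in> pverts T" "v \<notin> A" "(u, v) \<in> parcs T"
      using arc_leaving[of A] A by blast
    \<comment> \<open>A second neighbor \<open>u'\<close> of \<open>v\<close> in \<open>A\<close>
      yields a cycle: from \<open>v\<close> to \<open>u\<close>, along a path inside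
      \<open>A\<close> to \<open>u'\<close>, and back to \<open>v\<close>.\<close>
    have uniq: "u' = u" if u': "u' \<in> A" "(u', v) \<in> parcs T" for u'
    proof (rule ccontr)
      assume "u' \<noteq> u"
      obtain p where p: "set p \<subseteq> parcs T" "pcas u p u'" "distinct (pawalk_verts u p)"
          "set (pawalk_verts u p) \<subseteq> A"
        using tree_on_path[of A _ u u'] A uv u' by blast
      let ?q = "(v, u) # p @ [(u', v)]"
      have "awalk v ?q v"
        using p uv u' pcas_snoc[of u p u' v] arcs_symmetric by (auto simp: awalk_def)
      moreover have "distinct (tl (pawalk_verts v ?q))"
        using p uv by (auto simp: pawalk_verts_snoc)
      ultimately have "cycle ?q" unfolding cycle_def by auto
      \<comment> \<open>This excludes the closed walk of length 2 along a single edge, which the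
        acyclicity assumption permits.\<close>
      moreover have "p \<noteq> []" using p \<open>u' \<noteq> u\<close> by auto
      then have "3 \<le> length ?q" by (cases p) auto
      ultimately show False using tree_acyclic by blast
    qed
    have "x = u \<and> y = v \<or> x = v \<and> y = u"
      if "(x, y) \<in> parcs T" "x \<in> insert v A" "y \<in> insert v A" "\<not> (x \<in> A \<and> y \<in> A)" for x y
      using that uniq[of x] uniq[of y] no_loops'[of x y] arcs_symmetric[of x y] by auto
    then have "parcs T \<inter> insert v A \<times> insert v A = (parcs T \<inter> A \<times> A) \<union> {(u, v), (v, u)}"
      using uv arcs_symmetric[of u v] by auto
    then have "P (insert v A)" using A uv tree_on.add_leaf[of A _ u v] by (simp add: P_def)
    then have "card (insert v A) \<le> card A" by (rule max)
    moreover have "finite A" using A pair_finite_verts finite_subset by blast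
    ultimately show False using uv by simp
  qed
  moreover have "parcs T \<inter> pverts T \<times> pverts T = parcs T" using wellformed' by auto
  ultimately show ?thesis using A by simp
qed

lemma out_degree_eq: "out_degree (with_proj T) v = card (parcs T `` {v})"
proof -
  have "out_arcs (with_proj T) v = Pair v ` (parcs T `` {v})"
    by (auto simp: out_arcs_def)
  then show ?thesis by (simp add: out_degree_def card_image inj_on_def)
qed

lemma finite_nbrs: "finite (parcs T `` {v})"
  using pair_finite_arcs by (rule finite_Image)

lemma sum_degrees: "(\<Sum>v\<in>pverts T. card (parcs T `` {v})) + 2 = 2 * card (pverts T)"
proof -
  have "parcs T = (SIGMA v:pverts T. parcs T `` {v})" using wellformed' by auto
  then have "card (parcs T) = (\<Sum>v\<in>pverts T. card (parcs T `` {v}))"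
    using card_SigmaI[OF pair_finite_verts, of "\<lambda>v. parcs T `` {v}"] finite_nbrs by simp
  then show ?thesis using tree_on_card_arcs[OF tree_on_graph] by simp
qed

lemma degree_pos:
  assumes "v \<in> pverts T" "2 \<le> card (pverts T)"
  shows "1 \<le> card (parcs T `` {v})"
proof -
  have "pverts T \<noteq> {v}" using assms by auto
  then obtain y where "y \<in> pverts T - {v}" using assms by blast
  then obtain u where "(v, u) \<in> parcs T" using arc_leaving[of "{v}" v y] assms by auto
  then have "parcs T `` {v} \<noteq> {}" by blast
  then show ?thesis using finite_nbrs by (simp add: Suc_le_eq card_gt_0_iff)
qed

definition leaves :: "'a set" where
  "leaves = {v \<in> pverts T. card (parcs T `` {v}) = 1}"

text \<open>The degrees sum to 2n - 2, so the excess over 2 at a node of maximal degree has to be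
  compensated by leaves, each of which falls short of 2 by one.\<close>

lemma max_degree_le_card_leaves:
  assumes "2 \<le> max_degree T" "2 \<le> card (pverts T)"
  shows "max_degree T \<le> card leaves"
proof -
  let ?d = "\<lambda>v. card (parcs T `` {v})"
  have "max_degree T \<in> ?d ` pverts T"
    unfolding max_degree_def out_degree_eq using assms pair_finite_verts
    by (intro Max_in) auto
  then obtain w where w: "w \<in> pverts T" "?d w = max_degree T" by auto
  \<comment> \<open>A lower bound for the degree: \<open>max_degree T\<close> at \<open>w\<close>,
    which is no leaf, 1 at leaves and 2 elsewhere.\<close>
  define e where "e v = 2 + (if v = w then max_degree T - 2 else 0) - of_bool (v \<in> leaves)" for v
  have "(\<Sum>v\<in>pverts T. int (e v)) \<le> (\<Sum>v\<in>pverts T. int (?d v))"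
  proof (rule sum_mono)
    fix v assume v: "v \<in> pverts T"
    show "int (e v) \<le> int (?d v)"
      using degree_pos[OF v assms(2)] w assms v by (auto simp: e_def leaves_def)
  qed
  moreover have "int (e v) = 2 + (if v = w then int (max_degree T) - 2 else 0) - of_bool (v \<in> leaves)" for v
    using assms by (auto simp: e_def of_nat_diff)
  moreover have "(\<Sum>v\<in>pverts T. of_bool (v \<in> leaves)) = int (card leaves)"
  proof -
    have "pverts T \<inter> {v. v \<in> leaves} = leaves" by (auto simp: leaves_def)
    then show ?thesis using pair_finite_verts by (simp add: sum.If_cases of_bool_def)
  qed
  ultimately have "2 * int (card (pverts T)) + (int (max_degree T) - 2) - int (card leaves)
      \<le> int (\<Sum>v\<in>pverts T. ?d v)"
    using w pair_finite_verts by (simp add: sum.distrib sum_subtractf)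
  then show ?thesis using sum_degrees by linarith
qed

text \<open>Two adjacent leaves would form the whole tree, with maximal degree 1.\<close>

lemma nbr_of_leaf:
  assumes "2 \<le> max_degree T" "v \<in> leaves"
  obtains u where "u \<in> pverts T - leaves" "(v, u) \<in> parcs T"
proof -
  obtain u where u: "parcs T `` {v} = {u}"
    using assms by (auto simp: leaves_def card_1_singleton_iff)
  have uV: "u \<in> pverts T" "v \<in> pverts T" using u wellformed' by blast+
  have "u \<notin> leaves"
  proof
    assume "u \<in> leaves"
    then obtain x where "parcs T `` {u} = {x}" by (auto simp: leaves_def card_1_singleton_iff)
    moreover have "(u, v) \<in> parcs T" using u arcs_symmetric by blast
    then have "v \<in> parcs T `` {u}" by simp
    ultimately have uv: "parcs T `` {u} = {v}" by simp
    have "pverts T = {u, v}"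
    proof (rule ccontr)
      assume "pverts T \<noteq> {u, v}"
      then obtain y where "y \<in> pverts T - {u, v}" using uV by blast
      then show False using arc_leaving[of "{u, v}" u y] uV u uv by auto
    qed
    then have "max_degree T = 1" unfolding max_degree_def out_degree_eq using u uv by simp
    with assms show False by simp
  qed
  with that u uV show ?thesis by blast
qed

end

section \<open>Counting colorings with few bad edges at each node\<close>

text \<open>The edge between \<open>v\<close> and \<open>u\<close> is bad if
  \<open>c u = g (c v)\<close>. The capacities \<open>f\<close> are arbitrary because the induction
  lowers them at single nodes.\<close>

definition bounded_colorings ::
  "'a set \<Rightarrow> ('a \<times> 'a) set \<Rightarrow> (nat \<Rightarrow> nat) \<Rightarrow> ('a \<Rightarrow> nat) \<Rightarrow> ('a \<Rightarrow> nat) set" where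
  "bounded_colorings A R g f =
     {c \<in> A \<rightarrow>\<^sub>E {0, 1}. \<forall>v\<in>A. card {u. (v, u) \<in> R \<and> c u = g (c v)} \<le> f v}"

lemma finite_bounded_colorings: "finite A \<Longrightarrow> finite (bounded_colorings A R g f)"
  by (rule finite_subset[of _ "A \<rightarrow>\<^sub>E {0, 1}"]) (auto simp: bounded_colorings_def finite_PiE)

lemma restrict_in_PiE: "c \<in> B \<rightarrow>\<^sub>E C \<Longrightarrow> A \<subseteq> B \<Longrightarrow> restrict c A \<in> A \<rightarrow>\<^sub>E C"
  by (auto simp: PiE_iff)

text \<open>Deleting the leaf \<open>v\<close> affects the bad edges of \<open>u\<close> only, whose
  number drops by one exactly when the deleted edge is bad.\<close>

lemma restrict_bounded_coloring:
  assumes c: "c \<in> bounded_colorings (insert v A) (R \<union> {(u, v), (v, u)}) g f"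
    and R: "R \<subseteq> A \<times> A" "finite A" "u \<in> A" "v \<notin> A"
    and f': "\<And>x. x \<in> A \<Longrightarrow> x \<noteq> u \<Longrightarrow> f x \<le> f' x"
    and f'u: "if c v = g (c u) then f u \<le> Suc (f' u) else f u \<le> f' u"
  shows "restrict c A \<in> bounded_colorings A R g f'"
proof -
  let ?R' = "R \<union> {(u, v), (v, u)}"
  let ?r = "restrict c A"
  have "card {y. (x, y) \<in> R \<and> ?r y = g (?r x)} \<le> f' x" if x: "x \<in> A" for x
  proof -
    define B where "B = {y. (x, y) \<in> R \<and> c y = g (c x)}"
    define B' where "B' = {y. (x, y) \<in> ?R' \<and> c y = g (c x)}"
    have B': "B' = B \<union> (if x = u \<and> c v = g (c u) then {v} else {})"
      unfolding B_def B'_def using R x by auto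
    have "B \<subseteq> A" "v \<notin> B" using R by (auto simp: B_def)
    moreover from this have "finite B" using R finite_subset by blast
    ultimately have "card B' = card B + (if x = u \<and> c v = g (c u) then 1 else 0)"
      unfolding B' by simp
    moreover have "card B' \<le> f x" using c x by (auto simp: bounded_colorings_def B'_def)
    ultimately have "card B \<le> f' x" using f'[OF x] f'u by (cases "x = u") (auto split: if_splits)
    also have "B = {y. (x, y) \<in> R \<and> ?r y = g (?r x)}" using R x by (auto simp: B_def)
    finally show ?thesis .
  qed
  moreover have "?r \<in> A \<rightarrow>\<^sub>E {0, 1}"
    using c by (intro restrict_in_PiE[of c "insert v A"]) (auto simp: bounded_colorings_def)
  ultimately show ?thesis by (simp add: bounded_colorings_def)
qed

text \<open>With \<open>s\<close> the total capacity without the new leaf \<open>v\<close>, at most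
  \<open>2 * fib (1 + s)\<close> colorings have a good edge at \<open>v\<close>. If some have a bad
  one, they number at most \<open>2 * fib s\<close>, and \<open>f v\<close> is positive, so the
  Fibonacci recurrence applies.\<close>

lemma card_bounded_colorings:
  assumes "tree_on A R"
    and g: "g \<in> {0, 1} \<rightarrow> {0, 1}" "\<And>x. x \<in> {0, 1} \<Longrightarrow> g (g x) = x"
  shows "card (bounded_colorings A R g f) \<le> 2 * fib (1 + (\<Sum>v\<in>A. f v))"
  using assms(1)
proof (induction arbitrary: f rule: tree_on.induct)
  case (single r)
  have "card (bounded_colorings {r} {} g f) \<le> card ({r} \<rightarrow>\<^sub>E {0, 1::nat})"
    by (rule card_mono) (auto simp: bounded_colorings_def finite_PiE)
  also have "\<dots> = 2" by (simp add: card_PiE)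
  also have "fib (Suc 0) \<le> fib (1 + f r)" by (rule fib_mono) simp
  then have "2 \<le> 2 * fib (1 + f r)" by simp
  finally show ?case by simp
next
  case (add_leaf A R u v)
  note fin = tree_on_finite[OF add_leaf.hyps(1)] and sub = tree_on_subset[OF add_leaf.hyps(1)]
  note uA = add_leaf.hyps(2) and vA = add_leaf.hyps(3)
  let ?R' = "R \<union> {(u, v), (v, u)}"
  define X where "X = bounded_colorings (insert v A) ?R' g f"
  define good where "good = {c \<in> X. c v \<noteq> g (c u)}"
  define bad where "bad = {c \<in> X. c v = g (c u)}"
  \<comment> \<open>The bad edge at \<open>v\<close> uses up one unit of the capacity of
    \<open>u\<close>.\<close>
  define f' where "f' = f(u := f u - 1)"
  define s where "s = (\<Sum>v\<in>A. f v)"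
  have X: "c \<in> insert v A \<rightarrow>\<^sub>E {0, 1}" if "c \<in> X" for c
    using that by (simp add: X_def bounded_colorings_def)
  have finX: "finite X" using fin by (simp add: X_def finite_bounded_colorings)
  have restrict_inj: "c = c'"
    if "restrict c A = restrict c' A" "c \<in> X" "c' \<in> X" "c v = c' v" for c c'
  proof (rule PiE_ext[OF X X])
    fix x assume "x \<in> insert v A"
    then show "c x = c' x" using that by (metis insertE restrict_apply')
  qed (use that in auto)
  have inj_good: "inj_on (\<lambda>c. restrict c A) good"
  proof (rule inj_onI)
    fix c c' assume cc: "c \<in> good" "c' \<in> good" "restrict c A = restrict c' A"
    then have "c u = c' u" using uA by (metis restrict_apply')
    moreover have "c \<in> X" "c' \<in> X" using cc by (auto simp: good_def)
    then have "c v \<in> {0, 1}" "c' v \<in> {0, 1}" "c u \<in> {0, 1}" using X uA by blast+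
    \<comment> \<open>With only two colors, being different from \<open>g (c u)\<close> determines
      the color of \<open>v\<close>.\<close>
    ultimately have "c v = c' v" using cc g(1) by (auto simp: good_def)
    with cc show "c = c'" using restrict_inj[of c c'] by (simp add: good_def)
  qed
  have inj_bad: "inj_on (\<lambda>c. restrict c A) bad"
  proof (rule inj_onI)
    fix c c' assume cc: "c \<in> bad" "c' \<in> bad" "restrict c A = restrict c' A"
    then have "c u = c' u" using uA by (metis restrict_apply')
    with cc show "c = c'" using restrict_inj[of c c'] by (simp add: bad_def)
  qed
  have "card good \<le> card (bounded_colorings A R g f)"
    using fin sub uA vA
    by (intro card_inj_on_le[OF inj_good])
       (auto simp: good_def X_def finite_bounded_colorings intro!: restrict_bounded_coloring)
  also have "\<dots> \<le> 2 * fib (1 + s)" unfolding s_def by (rule add_leaf.IH)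
  finally have good: "card good \<le> 2 * fib (1 + s)" .
  have "card bad \<le> card (bounded_colorings A R g f')"
    using fin sub uA vA
    by (intro card_inj_on_le[OF inj_bad])
       (auto simp: bad_def X_def finite_bounded_colorings f'_def intro!: restrict_bounded_coloring)
  also have "\<dots> \<le> 2 * fib (1 + (\<Sum>v\<in>A. f' v))" by (rule add_leaf.IH)
  finally have bad: "card bad \<le> 2 * fib (1 + (\<Sum>v\<in>A. f' v))" .
  \<comment> \<open>Since \<open>g\<close> is an involution, a bad edge is bad seen from either end
    and so counts against both capacities.\<close>
  have caps: "0 < f u \<and> 0 < f v" if "c \<in> bad" for c
  proof -
    have c: "c \<in> X" "c v = g (c u)" using that by (auto simp: bad_def)
    have "c u \<in> {0, 1}" using X[OF c(1)] uA by blast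
    then have "c u = g (c v)" using c g(2) by simp
    have pos: "0 < f x" if x: "x \<in> insert v A" "(x, y) \<in> ?R'" "c y = g (c x)" for x y
    proof -
      have "{y. (x, y) \<in> ?R' \<and> c y = g (c x)} \<subseteq> insert v A" using sub uA by auto
      then have "finite {y. (x, y) \<in> ?R' \<and> c y = g (c x)}"
        using fin by (meson finite.insertI finite_subset)
      then have "0 < card {y. (x, y) \<in> ?R' \<and> c y = g (c x)}"
        using x(2,3) card_gt_0_iff by blast
      also have "\<dots> \<le> f x" using c(1) x(1) by (auto simp: X_def bounded_colorings_def)
      finally show ?thesis .
    qed
    show ?thesis
      using pos[OF _ _ c(2)] pos[OF _ _ \<open>c u = g (c v)\<close>] uA by blast
  qed
  have "X = good \<union> bad" by (auto simp: good_def bad_def)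
  then have "card X \<le> card good + card bad" by (simp add: card_Un_le)
  also have "\<dots> \<le> 2 * fib (1 + s + f v)"
  proof (cases "bad = {}")
    case True
    have "fib (1 + s) \<le> fib (1 + s + f v)" by (rule fib_mono) simp
    with True good show ?thesis by simp
  next
    case False
    then have pos: "0 < f u" "0 < f v" using caps by auto
    have "s = f u + (\<Sum>v\<in>A - {u}. f v)" unfolding s_def using fin uA by (rule sum.remove)
    moreover have "(\<Sum>v\<in>A. f' v) = f' u + (\<Sum>v\<in>A - {u}. f' v)"
      using fin uA by (rule sum.remove)
    moreover have "(\<Sum>v\<in>A - {u}. f' v) = (\<Sum>v\<in>A - {u}. f v)"
      by (rule sum.cong) (auto simp: f'_def)
    ultimately have "1 + (\<Sum>v\<in>A. f' v) = s" using pos by (simp add: f'_def)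
    with bad good have "card good + card bad \<le> 2 * fib (Suc (Suc s))" by simp
    \<comment> \<open>The missing unit in the index is supplied by \<open>f v\<close>, which is at
      least 1.\<close>
    also have "fib (Suc (Suc s)) \<le> fib (1 + s + f v)" using pos by (intro fib_mono) simp
    finally show ?thesis by simp
  qed
  also have "1 + s + f v = 1 + (\<Sum>v\<in>insert v A. f v)" using fin vA by (simp add: s_def)
  finally show ?case by (simp add: X_def)
qed

text \<open>The edge \<open>vu\<close> is bad iff \<open>c u = g (c v)\<close>; the involution \<open>g\<close> covers both processes at once.\<close>

lemma pure_2_cycle_bad_nbrs:
  fixes g :: "nat \<Rightarrow> nat"
  assumes "M = minority T \<and> g = (\<lambda>x. 1 - x) \<or> M = majority T \<and> g = (\<lambda>x. x)"
    and "pair_graph T" "c \<in> pure_2_cycles T M" "v \<in> pverts T"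
  shows "2 * card {u. (v, u) \<in> parcs T \<and> c u = g (c v)} < card (parcs T `` {v})"
proof -
  interpret pair_graph T by fact
  have c: "c \<in> pverts T \<rightarrow>\<^sub>E {0, 1}" "M c v \<noteq> c v"
    using assms by (auto simp: pure_2_cycles_def colorings_def)
  have N: "colored_nbrs T c i v = {u. (v, u) \<in> parcs T \<and> c u = i}" for i
    using in_arcsD2 by (auto simp: colored_nbrs_def)
  have fin: "finite (colored_nbrs T c i v)" for i
    using pair_finite_verts by (simp add: colored_nbrs_def)
  have cv: "c v \<in> {0, 1}" using c assms by auto
  have nbr: "c u = c v \<or> c u = 1 - c v" if "(v, u) \<in> parcs T" for u
  proof -
    have "c u \<in> {0, 1}" using c in_arcsD2[OF that] by auto
    with cv show ?thesis by auto
  qed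
  \<comment> \<open>The two color classes partition the neighborhood. A flip means that the class of
    bad neighbors is strictly the smaller one, hence less than half of the degree.\<close>
  have "parcs T `` {v} = colored_nbrs T c (c v) v \<union> colored_nbrs T c (1 - c v) v"
    unfolding N by (auto dest: nbr)
  moreover have "colored_nbrs T c (c v) v \<inter> colored_nbrs T c (1 - c v) v = {}"
    unfolding N using cv by auto
  ultimately have "card (parcs T `` {v})
      = card (colored_nbrs T c (c v) v) + card (colored_nbrs T c (1 - c v) v)"
    using fin by (simp add: card_Un_disjoint)
  then show ?thesis
    using assms(1) c assms(4) by (auto simp: N minority_def majority_def split: if_splits)
qed

section \<open>The Fibonacci bound and the power bound\<close>

context undirected_tree
begin

lemma card_pure_2_cycles_le_fib:
  fixes g :: "nat \<Rightarrow> nat"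
  assumes M: "M = minority T \<and> g = (\<lambda>x. 1 - x) \<or> M = majority T \<and> g = (\<lambda>x. x)"
  shows "card (pure_2_cycles T M) \<le> 2 * fib (card (pverts T) div 2)"
proof (cases "pure_2_cycles T M = {}")
  case False
  let ?d = "\<lambda>v. card (parcs T `` {v})"
  \<comment> \<open>For positive degree this is half the degree, rounded up, minus one.\<close>
  let ?f = "\<lambda>v. (?d v - 1) div 2"
  note bad = pure_2_cycle_bad_nbrs[OF M pair_graph_axioms]
  have "pure_2_cycles T M \<subseteq> bounded_colorings (pverts T) (parcs T) g ?f"
  proof
    fix c assume c: "c \<in> pure_2_cycles T M"
    have "card {u. (v, u) \<in> parcs T \<and> c u = g (c v)} \<le> ?f v" if "v \<in> pverts T" for v
      using bad[OF c that] by linarith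
    with c show "c \<in> bounded_colorings (pverts T) (parcs T) g ?f"
      by (simp add: bounded_colorings_def pure_2_cycles_def colorings_def)
  qed
  then have "card (pure_2_cycles T M) \<le> card (bounded_colorings (pverts T) (parcs T) g ?f)"
    using pair_finite_verts by (intro card_mono finite_bounded_colorings)
  also have "\<dots> \<le> 2 * fib (1 + (\<Sum>v\<in>pverts T. ?f v))"
    using M by (intro card_bounded_colorings tree_on_graph) auto
  also have "1 + (\<Sum>v\<in>pverts T. ?f v) \<le> card (pverts T) div 2"
  proof -
    \<comment> \<open>A pure 2-cycle exists in this case, and the strict inequality in
      \<open>bad\<close> then forces positive degrees. An isolated node would violate the
      estimate.\<close>
    have "2 * ?f v + 1 \<le> ?d v" if "v \<in> pverts T" for v
      using False bad that by fastforce
    then have "(\<Sum>v\<in>pverts T. 2 * ?f v + 1) \<le> (\<Sum>v\<in>pverts T. ?d v)" by (rule sum_mono)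
    then have "2 * (\<Sum>v\<in>pverts T. ?f v) + card (pverts T) \<le> (\<Sum>v\<in>pverts T. ?d v)"
      unfolding sum.distrib sum_distrib_left by simp
    then show ?thesis using sum_degrees by linarith
  qed
  then have "2 * fib (1 + (\<Sum>v\<in>pverts T. ?f v)) \<le> 2 * fib (card (pverts T) div 2)"
    by (simp add: fib_mono)
  finally show ?thesis .
qed simp

text \<open>A pure 2-cycle is determined by its colors on the inner nodes, and there are at most n -
  \<open>max_degree T\<close> of these once the maximal degree is at least 2. Smaller trees follow
  from the Fibonacci bound.\<close>

lemma card_pure_2_cycles_le_power:
  fixes g :: "nat \<Rightarrow> nat"
  assumes M: "M = minority T \<and> g = (\<lambda>x. 1 - x) \<or> M = majority T \<and> g = (\<lambda>x. x)"
  shows "card (pure_2_cycles T M) \<le> 2 ^ (card (pverts T) - max_degree T)"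
proof (cases "2 \<le> max_degree T \<and> 2 \<le> card (pverts T)")
  case True
  define I where "I = pverts T - leaves"
  have col: "c \<in> pverts T \<rightarrow>\<^sub>E {0, 1}" if "c \<in> pure_2_cycles T M" for c
    using that by (simp add: pure_2_cycles_def colorings_def)
  have leaf: "c v \<noteq> c' v \<Longrightarrow> c u \<noteq> c' u"
    if c: "c \<in> pure_2_cycles T M" "c' \<in> pure_2_cycles T M"
      and v: "v \<in> leaves" "(v, u) \<in> parcs T" for c c' u v
  proof -
    \<comment> \<open>A node of degree 1 has room for no bad edge, so its only edge is good.\<close>
    have good: "b u \<noteq> g (b v)" if "b \<in> pure_2_cycles T M" for b
    proof -
      have "2 * card {u. (v, u) \<in> parcs T \<and> b u = g (b v)} < 1"
        using pure_2_cycle_bad_nbrs[OF M pair_graph_axioms that, of v] v by (simp add: leaves_def)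
      moreover have "finite {u. (v, u) \<in> parcs T \<and> b u = g (b v)}"
        by (rule finite_subset[OF _ finite_nbrs[of v]]) auto
      ultimately show ?thesis using v by auto
    qed
    have "v \<in> pverts T" "u \<in> pverts T" using v wellformed' by blast+
    then have "c v \<in> {0, 1}" "c' v \<in> {0, 1}" "c u \<in> {0, 1}" "c' u \<in> {0, 1}"
      using col c by blast+
    then show "c v \<noteq> c' v \<Longrightarrow> c u \<noteq> c' u" using good[OF c(1)] good[OF c(2)] M by auto
  qed
  have "inj_on (\<lambda>c. restrict c I) (pure_2_cycles T M)"
  proof (rule inj_onI)
    fix c c' assume c: "c \<in> pure_2_cycles T M" "c' \<in> pure_2_cycles T M"
      and eq: "restrict c I = restrict c' I"
    have I: "c x = c' x" if "x \<in> I" for x using that eq by (metis restrict_apply')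
    show "c = c'"
    proof (rule PiE_ext[OF col col])
      fix x assume x: "x \<in> pverts T"
      show "c x = c' x"
      proof (cases "x \<in> leaves")
        case xl: True
        then obtain u where "u \<in> I" "(x, u) \<in> parcs T"
          using nbr_of_leaf True unfolding I_def by blast
        then show ?thesis using leaf[OF c xl] I by blast
      qed (use x I in \<open>simp add: I_def\<close>)
    qed (use c in auto)
  qed
  moreover have "finite (I \<rightarrow>\<^sub>E {0, 1::nat})"
    using pair_finite_verts by (simp add: I_def finite_PiE)
  moreover have "(\<lambda>c. restrict c I) ` pure_2_cycles T M \<subseteq> I \<rightarrow>\<^sub>E {0, 1}"
    by (intro image_subsetI restrict_in_PiE[OF col]) (auto simp: I_def)
  ultimately have "card (pure_2_cycles T M) \<le> card (I \<rightarrow>\<^sub>E {0, 1::nat})"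
    using card_inj_on_le by blast
  also have "\<dots> = 2 ^ card I" using pair_finite_verts by (simp add: I_def card_PiE numeral_2_eq_2)
  also have "card I = card (pverts T) - card leaves"
    unfolding I_def using pair_finite_verts
    by (intro card_Diff_subset) (auto simp: leaves_def intro: finite_subset)
  also have "(2::nat) ^ (card (pverts T) - card leaves) \<le> 2 ^ (card (pverts T) - max_degree T)"
    using max_degree_le_card_leaves True by (intro power_increasing) auto
  finally show ?thesis .
next
  case False
  let ?d = "\<lambda>v. card (parcs T `` {v})"
  have d: "?d v \<le> max_degree T" if "v \<in> pverts T" for v
    unfolding max_degree_def out_degree_eq using that pair_finite_verts by (intro Max_ge) auto
  have D: "max_degree T \<le> 1"
  \<comment> \<open>A degree of at least 2 makes the degree sum at least 2, hence n at least 2,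
    contrary to the case assumption.\<close>
  proof (rule ccontr)
    assume big: "\<not> max_degree T \<le> 1"
    have "pverts T \<noteq> {}"
      using tree_on_graph by (auto elim: tree_on.cases)
    then have "max_degree T \<in> ?d ` pverts T"
      unfolding max_degree_def out_degree_eq using pair_finite_verts by (intro Max_in) auto
    then obtain w where "w \<in> pverts T" "?d w = max_degree T" by auto
    moreover from this have "?d w \<le> (\<Sum>v\<in>pverts T. ?d v)"
      using pair_finite_verts by (intro member_le_sum) auto
    ultimately show False using sum_degrees big False by linarith
  qed
  \<comment> \<open>Degrees at most 1 give 2n - 2 \<le> n.\<close>
  have "(\<Sum>v\<in>pverts T. ?d v) \<le> (\<Sum>v\<in>pverts T. 1)"
    using d D by (intro sum_mono) (meson order_trans)
  then have n: "card (pverts T) \<le> 2" using sum_degrees by simp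
  show ?thesis
  \<comment> \<open>For two nodes the Fibonacci bound is \<open>2 * fib 1\<close>, that is 2; for a
    single node it is \<open>2 * fib 0\<close>, so there is no pure 2-cycle.\<close>
  proof (cases "card (pverts T) = 2")
    case True
    have "card (pure_2_cycles T M) \<le> 2 ^ 1"
      using card_pure_2_cycles_le_fib[OF M] True by simp
    also have "\<dots> \<le> 2 ^ (card (pverts T) - max_degree T)"
      using D True by (intro power_increasing) auto
    finally show ?thesis .
  next
    case False
    then have "card (pverts T) div 2 = 0" using n by simp
    then show ?thesis using card_pure_2_cycles_le_fib[OF M] by simp
  qed
qed

end

theorem theorem3:
  fixes T :: "'a pair_pre_digraph"
    and M :: "('a \<Rightarrow> nat) \<Rightarrow> 'a \<Rightarrow> nat"
    and n \<Delta> :: nat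
  assumes "undirected_tree T"
    and "M = minority T \<or> M = majority T"
    and "n = card (pverts T)"
    and "\<Delta> = max_degree T"
  shows "card (pure_2_cycles T M) \<le> min (2 ^ (n - \<Delta>)) (2 * fib (n div 2))"
proof -
  obtain g :: "nat \<Rightarrow> nat"
    where "M = minority T \<and> g = (\<lambda>x. 1 - x) \<or> M = majority T \<and> g = (\<lambda>x. x)"
    using assms(2) by blast
  then show ?thesis
    using undirected_tree.card_pure_2_cycles_le_power[OF assms(1)]
      undirected_tree.card_pure_2_cycles_le_fib[OF assms(1)] assms(3,4)
    by simp
qed

end
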